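(* Let $G$ be a finite nonempty simple bipartite graph. Then $$\left\lceil\frac{s(G)}{2}\right\rceil\leq d(G)\leq s(G).$$
   Context: Nonempty means having at least one edge. A vertex labeling of a graph $G$ is an injective map $f:V(G)\to\mathbb{Z}$. It induces the edge labelings $f^+,f^-:E(G)\to\mathbb{Z}$, $f^+(uv)=f(u)+f(v)$ and $f^-(uv)=|f(u)-f(v)|$; $|f^+|$ and $|f^-|$ denote the numbers of distinct values these take on $E(G)$. The sum index $s(G)$ (respectively, difference index $d(G)$) is the minimum positive integer $k$ such that there exists a vertex labeling $f$ of $G$ with $|f^+|=k$ (respectively, $|f^-|=k$). *)

theory Defs
  imports Complex_Main "Graph_Theory.Pair_Digraph"
begin

text \<open>
  A finite simple graph is a \<^locale>\<open>pair_graph\<close>: a finite loopless digraph with symmetric arc set,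
  in which an edge \<open>uv\<close> is represented by the two arcs \<open>(u, v)\<close> and \<open>(v, u)\<close>. Both induced edge
  labelings take the same value on these two arcs, so their ranges over the arcs and over the
  undirected edges coincide.
\<close>

definition bipartite :: "'a pair_pre_digraph \<Rightarrow> bool" where
  "bipartite G \<longleftrightarrow>
     (\<exists>X Y. pverts G = X \<union> Y \<and> X \<inter> Y = {} \<and> parcs G \<subseteq> X \<times> Y \<union> Y \<times> X)"

text \<open>Labelings are total functions; only their values on the vertices matter.\<close>

definition vertex_labeling :: "'a pair_pre_digraph \<Rightarrow> ('a \<Rightarrow> int) \<Rightarrow> bool" where
  "vertex_labeling G f \<longleftrightarrow> inj_on f (pverts G)"

definition induced_sum :: "('a \<Rightarrow> int) \<Rightarrow> 'a \<times> 'a \<Rightarrow> int" where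
  "induced_sum f = (\<lambda>(u, v). f u + f v)"

definition induced_diff :: "('a \<Rightarrow> int) \<Rightarrow> 'a \<times> 'a \<Rightarrow> int" where
  "induced_diff f = (\<lambda>(u, v). \<bar>f u - f v\<bar>)"

definition num_sums :: "'a pair_pre_digraph \<Rightarrow> ('a \<Rightarrow> int) \<Rightarrow> nat" where
  "num_sums G f = card (induced_sum f ` parcs G)"

definition num_diffs :: "'a pair_pre_digraph \<Rightarrow> ('a \<Rightarrow> int) \<Rightarrow> nat" where
  "num_diffs G f = card (induced_diff f ` parcs G)"

definition sum_index :: "'a pair_pre_digraph \<Rightarrow> nat" where
  "sum_index G = (LEAST k. 0 < k \<and> (\<exists>f. vertex_labeling G f \<and> num_sums G f = k))"

definition difference_index :: "'a pair_pre_digraph \<Rightarrow> nat" where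
  "difference_index G = (LEAST k. 0 < k \<and> (\<exists>f. vertex_labeling G f \<and> num_diffs G f = k))"

text \<open>The two minima exist whenever the graph is finite and has an edge.\<close>

lemma (in pair_graph) ex_vertex_labeling: "\<exists>f. vertex_labeling G f"
proof -
  obtain h :: "'a \<Rightarrow> nat" where "inj_on h (pverts G)"
    using finite_imp_inj_to_nat_seg[OF pair_finite_verts] by blast
  then have "vertex_labeling G (\<lambda>v. int (h v))"
    by (auto simp: vertex_labeling_def inj_on_def)
  then show ?thesis by blast
qed

lemma (in pair_graph) sum_index_attained:
  assumes "parcs G \<noteq> {}"
  shows "0 < sum_index G \<and> (\<exists>f. vertex_labeling G f \<and> num_sums G f = sum_index G)"
proof -
  obtain f where "vertex_labeling G f" using ex_vertex_labeling by blast
  moreover have "0 < num_sums G f"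
    using assms pair_finite_arcs by (simp add: num_sums_def card_gt_0_iff)
  ultimately have "\<exists>k. 0 < k \<and> (\<exists>f. vertex_labeling G f \<and> num_sums G f = k)" by blast
  then show ?thesis unfolding sum_index_def by (rule LeastI_ex)
qed

lemma (in pair_graph) difference_index_attained:
  assumes "parcs G \<noteq> {}"
  shows "0 < difference_index G \<and>
    (\<exists>f. vertex_labeling G f \<and> num_diffs G f = difference_index G)"
proof -
  obtain f where "vertex_labeling G f" using ex_vertex_labeling by blast
  moreover have "0 < num_diffs G f"
    using assms pair_finite_arcs by (simp add: num_diffs_def card_gt_0_iff)
  ultimately have "\<exists>k. 0 < k \<and> (\<exists>f. vertex_labeling G f \<and> num_diffs G f = k)" by blast
  then show ?thesis unfolding difference_index_def by (rule LeastI_ex)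
qed

end

theory Submission
  imports Defs
begin

text \<open>
  Let \<open>X\<close> and \<open>Y\<close> be the two sides of \<open>G\<close>. Keep a labeling \<open>f\<close> on \<open>X\<close> and replace it by
  \<open>c - f\<close> on \<open>Y\<close>. As every edge joins a vertex of \<open>X\<close> to a vertex of \<open>Y\<close>, this exchanges the roles
  of sums and differences, up to the constant \<open>c\<close> and a sign:
  \<^item> the new difference on an edge is \<open>\<bar>s - c\<bar>\<close>, where \<open>s\<close> is the old sum;
  \<^item> the new sum is \<open>c + d\<close> or \<open>c - d\<close>, where \<open>d\<close> is the old difference.
  So a labeling with \<open>k\<close> sums gives one with at most \<open>k\<close> differences. In the other direction,
  a difference does not record its sign, so each can produce two sums, and a labeling with \<open>k\<close>
  differences gives one with at most \<open>2 * k\<close> sums; hence the factor 2. The reflected labeling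
  is injective as soon as \<open>c\<close> avoids the finitely many integers \<open>f x + f y\<close>
  (\<open>ex_vertex_labeling_reflect\<close>), so both estimates apply to optimal labelings.
\<close>

definition reflect_outside :: "'a set \<Rightarrow> int \<Rightarrow> ('a \<Rightarrow> int) \<Rightarrow> 'a \<Rightarrow> int" where
  "reflect_outside X c f v = (if v \<in> X then f v else c - f v)"

lemma induced_diff_reflect:
  assumes "(u \<in> X) \<noteq> (v \<in> X)"
  shows "induced_diff (reflect_outside X c f) (u, v) = \<bar>induced_sum f (u, v) - c\<bar>"
  using assms by (auto simp: induced_diff_def induced_sum_def reflect_outside_def)

lemma induced_sum_reflect:
  assumes "(u \<in> X) \<noteq> (v \<in> X)"
  shows "induced_sum (reflect_outside X c f) (u, v)
    \<in> {c + induced_diff f (u, v), c - induced_diff f (u, v)}"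
  using assms by (auto simp: induced_diff_def induced_sum_def reflect_outside_def)

lemma (in pair_graph) sum_index_le:
  assumes "parcs G \<noteq> {}" "vertex_labeling G f"
  shows "sum_index G \<le> num_sums G f"
proof -
  have "0 < num_sums G f"
    using assms(1) pair_finite_arcs by (simp add: num_sums_def card_gt_0_iff)
  then show ?thesis
    unfolding sum_index_def using assms(2) by (blast intro: Least_le)
qed

lemma (in pair_graph) difference_index_le:
  assumes "parcs G \<noteq> {}" "vertex_labeling G f"
  shows "difference_index G \<le> num_diffs G f"
proof -
  have "0 < num_diffs G f"
    using assms(1) pair_finite_arcs by (simp add: num_diffs_def card_gt_0_iff)
  then show ?thesis
    unfolding difference_index_def using assms(2) by (blast intro: Least_le)
qed

text \<open>
  A reflected and an unreflected vertex collide only if \<open>c\<close> is the sum of their labels, and a finite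
  graph excludes only finitely many values of \<open>c\<close> in this way.
\<close>

lemma (in pair_graph) ex_vertex_labeling_reflect:
  assumes "vertex_labeling G f"
  shows "\<exists>c. vertex_labeling G (reflect_outside X c f)"
proof -
  let ?S = "(\<lambda>(u, v). f u + f v) ` (pverts G \<times> pverts G)"
  have "finite ?S" using pair_finite_verts by simp
  then obtain c where c: "c \<notin> ?S"
    using ex_new_if_finite infinite_UNIV_int by blast
  have no_collision: "f u \<noteq> c - f v" if "u \<in> pverts G" "v \<in> pverts G" for u v
  proof
    assume "f u = c - f v"
    then have "c = f u + f v" by simp
    with c that show False by force
  qed
  have "inj_on (reflect_outside X c f) (pverts G)"
  proof (rule inj_onI)
    fix u v
    assume uv: "u \<in> pverts G" "v \<in> pverts G"
      and eq: "reflect_outside X c f u = reflect_outside X c f v"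
    have "f u = f v"
      using eq no_collision[OF uv] no_collision[OF uv(2,1)]
      by (auto simp: reflect_outside_def split: if_splits)
    with assms uv show "u = v" by (auto simp: vertex_labeling_def inj_on_def)
  qed
  then show ?thesis by (auto simp: vertex_labeling_def)
qed

lemma (in pair_graph) difference_index_le_sum_index:
  assumes "parcs G \<noteq> {}" and sides: "\<And>u v. (u, v) \<in> parcs G \<Longrightarrow> (u \<in> X) \<noteq> (v \<in> X)"
  shows "difference_index G \<le> sum_index G"
proof -
  obtain f where f: "vertex_labeling G f" "num_sums G f = sum_index G"
    using sum_index_attained assms(1) by blast
  obtain c where g: "vertex_labeling G (reflect_outside X c f)"
    using ex_vertex_labeling_reflect f(1) by blast
  have "induced_diff (reflect_outside X c f) ` parcs G
      = (\<lambda>s. \<bar>s - c\<bar>) ` induced_sum f ` parcs G"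
    unfolding image_image using induced_diff_reflect[OF sides] by (intro image_cong) auto
  then have "num_diffs G (reflect_outside X c f) \<le> num_sums G f"
    unfolding num_diffs_def num_sums_def using pair_finite_arcs by (simp add: card_image_le)
  with difference_index_le[OF assms(1) g] f(2) show ?thesis by simp
qed

lemma (in pair_graph) sum_index_le_twice_difference_index:
  assumes "parcs G \<noteq> {}" and sides: "\<And>u v. (u, v) \<in> parcs G \<Longrightarrow> (u \<in> X) \<noteq> (v \<in> X)"
  shows "sum_index G \<le> 2 * difference_index G"
proof -
  obtain f where f: "vertex_labeling G f" "num_diffs G f = difference_index G"
    using difference_index_attained assms(1) by blast
  obtain c where g: "vertex_labeling G (reflect_outside X c f)"
    using ex_vertex_labeling_reflect f(1) by blast
  let ?D = "induced_diff f ` parcs G"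
  have fin: "finite ?D" using pair_finite_arcs by simp
  have "induced_sum (reflect_outside X c f) ` parcs G \<subseteq> (+) c ` ?D \<union> (-) c ` ?D"
    using induced_sum_reflect[OF sides] by fastforce
  then have "num_sums G (reflect_outside X c f) \<le> card ((+) c ` ?D \<union> (-) c ` ?D)"
    unfolding num_sums_def using fin by (intro card_mono) auto
  also have "\<dots> \<le> card ((+) c ` ?D) + card ((-) c ` ?D)"
    by (rule card_Un_le)
  also have "\<dots> \<le> card ?D + card ?D"
    by (intro add_mono card_image_le fin)
  finally have "num_sums G (reflect_outside X c f) \<le> 2 * num_diffs G f"
    by (simp add: num_diffs_def)
  with sum_index_le[OF assms(1) g] f(2) show ?thesis by simp
qed

theorem theorem3p3:
  fixes G :: "'a pair_pre_digraph"
  assumes "pair_graph G"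
    and "parcs G \<noteq> {}"
    and "bipartite G"
  shows "\<lceil>real (sum_index G) / 2\<rceil> \<le> int (difference_index G) \<and>
    difference_index G \<le> sum_index G"
proof -
  interpret pair_graph G by fact
  obtain X Y where XY: "X \<inter> Y = {}" "parcs G \<subseteq> X \<times> Y \<union> Y \<times> X"
    using assms(3) unfolding bipartite_def by blast
  have sides: "(u \<in> X) \<noteq> (v \<in> X)" if "(u, v) \<in> parcs G" for u v
    using that XY by blast
  have "sum_index G \<le> 2 * difference_index G"
    using sum_index_le_twice_difference_index[OF assms(2) sides] .
  then have "\<lceil>real (sum_index G) / 2\<rceil> \<le> int (difference_index G)"
    by (simp add: ceiling_le_iff)
  with difference_index_le_sum_index[OF assms(2) sides] show ?thesis by simp
qed

end
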